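(* Let $\boldsymbol{x}\in\mathcal{F}^K=(\mathbb{R}^2)^{\otimes K}$, $\boldsymbol{x}\neq0$, have a matrix product state representation $\boldsymbol{x}=\tau(\mathsf{X})$ with minimal ranks $\mathsf{r}=(r_1,\ldots,r_{K-1})$, and let $\boldsymbol{P}$ be the particle number operator on $\mathcal{F}^K$. Then for $N=1,\ldots,K$, one has $\boldsymbol{P}\boldsymbol{x}=N\boldsymbol{x}$ if and only if the representation $\mathsf{X}=(X_1,\ldots,X_K)$ of $\boldsymbol{x}$ with ranks $\mathsf{r}$ can be chosen such that the following holds: for $k=1,\ldots,K$ and for all $$n\in\mathcal{K}_k:=\bigl\{\max\{0,N-K+k\},\ldots,\min\{N,k\}\bigr\}$$ there exist $\mathcal{S}_{k,n}\subseteq\{1,\ldots,r_k\}$ such that $$\boldsymbol{P}_k^{\leq}\,\tau^{\leq}_{k,j}(\mathsf{X})=n\,\tau^{\leq}_{k,j}(\mathsf{X}),\qquad \boldsymbol{P}_k^{>}\,\tau^{>}_{k,j}(\mathsf{X})=(N-n)\,\tau^{>}_{k,j}(\mathsf{X}),\qquad j\in\mathcal{S}_{k,n},$$ and the matrices $X_k^{\{\beta\}}$, $\beta=0,1$, have nonzero entries only in the blocks $$X_k^{\{0\}}\big|_{\mathcal{S}_{k-1,n}\times\mathcal{S}_{k,n}}\quad\text{for }n\in\mathcal{K}_{k-1}\cap\mathcal{K}_k,\qquad X_k^{\{1\}}\big|_{\mathcal{S}_{k-1,n}\times\mathcal{S}_{k,n+1}}\quad\text{for }n\in\mathcal{K}_{k-1}\cap(\mathcal{K}_k-1),$$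 where we set $\mathcal{S}_{0,0}=\mathcal{S}_{K,N}=\{1\}$.
   Context: Tensors in $\mathcal{F}^K=(\mathbb{R}^2)^{\otimes K}$ are indexed by $\alpha\in\{0,1\}^K$. Let $$S=\begin{pmatrix}1&0\\0&-1\end{pmatrix},\quad A=\begin{pmatrix}0&1\\0&0\end{pmatrix},\quad I=\begin{pmatrix}1&0\\0&1\end{pmatrix}.$$ The annihilation operators are $\boldsymbol{a}_i=S^{\otimes(i-1)}\otimes A\otimes I^{\otimes(K-i)}$, the creation operators are their adjoints $\boldsymbol{a}_i^*$, and the particle number operator is $\boldsymbol{P}=\sum_{i=1}^K\boldsymbol{a}_i^*\boldsymbol{a}_i$. Its truncated versions are $$\boldsymbol{P}_k^{\leq}=\sum_{i=1}^k I^{\otimes(i-1)}\otimes A^*A\otimes I^{\otimes(k-i)},\qquad \boldsymbol{P}_k^{>}=\sum_{i=k+1}^K I^{\otimes(i-k-1)}\otimes A^*A\otimes I^{\otimes(K-i)},$$ acting on $(\mathbb{R}^2)^{\otimes k}$ and $(\mathbb{R}^2)^{\otimes(K-k)}$, respectively (for $k=K$, $\boldsymbol{P}_K^{>}$ is the zero operator on $\mathbb{R}$). The set $\mathcal{K}_k$ is defined by the same formula also for $k=0$, so $\mathcal{K}_0=\{0\}$. $\mathcal{K}_k-1=\{n:n+1\in\mathcal{K}_k\}$. Matrix product states (MPS): a representation with ranks $(r_1,\ldots,r_{K-1})$, $r_0=r_K=1$, is a tuple $\mathsf{X}=(X_1,\ldots,X_K)$ of cores $X_k=(X_k(j,\beta,j'))$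 with $j=1,\ldots,r_{k-1}$, $\beta\in\{0,1\}$, $j'=1,\ldots,r_k$. Write $X_k^{\{\beta\}}=(X_k(j,\beta,j'))_{j,j'}\in\mathbb{R}^{r_{k-1}\times r_k}$. The represented tensor is $\tau(\mathsf{X})_\alpha=X_1^{\{\alpha_1\}}\cdots X_K^{\{\alpha_K\}}$. Partial representations are $$\tau^{\leq}_{k,j}(\mathsf{X})=\bigl((X_1^{\{\alpha_1\}}\cdots X_k^{\{\alpha_k\}})_{1,j}\bigr)_{\alpha_1,\ldots,\alpha_k},\qquad \tau^{>}_{k,j}(\mathsf{X})=\bigl((X_{k+1}^{\{\alpha_{k+1}\}}\cdots X_K^{\{\alpha_K\}})_{j,1}\bigr)_{\alpha_{k+1},\ldots,\alpha_K},$$ for $j=1,\ldots,r_k$ (with $\tau^{>}_{K,1}(\mathsf{X})=1$). Ranks are minimal if each $r_k$ is the smallest possible among all MPS representations of $\boldsymbol{x}$; equivalently, $r_k$ is the rank of the matricization of $\boldsymbol{x}$ with row index $(\alpha_1,\ldots,\alpha_k)$ and column index $(\alpha_{k+1},\ldots,\alpha_K)$. *)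

theory Defs
  imports "Jordan_Normal_Form.Matrix"
begin

text \<open>
  A tensor of order \<open>K\<close> is a function on index lists that vanishes outside \<open>{0,1}\<^sup>K\<close>, so that
  equality of tensors is equality of functions. List positions and matrix indices start at 0:
  the entry \<open>\<alpha>\<^sub>i\<close> is \<open>\<alpha> ! (i - 1)\<close>, and a rank index \<open>j = 1, \<dots>, r\<^sub>k\<close> becomes \<open>j < r k\<close>.
\<close>

type_synonym tensor = "nat list \<Rightarrow> real"

definition idx :: "nat \<Rightarrow> nat list set" where
  "idx K = {\<alpha>. length \<alpha> = K \<and> set \<alpha> \<subseteq> {0, 1}}"

definition fock :: "nat \<Rightarrow> tensor set" where
  "fock K = {x. \<forall>\<alpha>. \<alpha> \<notin> idx K \<longrightarrow> x \<alpha> = 0}"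

text \<open>
  A linear operator on \<open>fock K\<close> is given by its matrix, whose rows and columns are indexed by
  \<open>idx K\<close>; entries elsewhere are irrelevant.
\<close>

type_synonym operator = "nat list \<Rightarrow> nat list \<Rightarrow> real"

definition op_apply :: "nat \<Rightarrow> operator \<Rightarrow> tensor \<Rightarrow> tensor" where
  "op_apply K T x = (\<lambda>\<alpha>. if \<alpha> \<in> idx K then \<Sum>\<beta>\<in>idx K. T \<alpha> \<beta> * x \<beta> else 0)"

definition op_mult :: "nat \<Rightarrow> operator \<Rightarrow> operator \<Rightarrow> operator" where
  "op_mult K T U = (\<lambda>\<alpha> \<beta>. \<Sum>\<gamma>\<in>idx K. T \<alpha> \<gamma> * U \<gamma> \<beta>)"

definition op_adjoint :: "operator \<Rightarrow> operator" where
  "op_adjoint T = (\<lambda>\<alpha> \<beta>. T \<beta> \<alpha>)"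

lemma op_adjoint_inner:
  "(\<Sum>\<alpha>\<in>idx K. op_apply K T x \<alpha> * y \<alpha>) = (\<Sum>\<alpha>\<in>idx K. x \<alpha> * op_apply K (op_adjoint T) y \<alpha>)"
proof -
  have "(\<Sum>\<alpha>\<in>idx K. op_apply K T x \<alpha> * y \<alpha>)
      = (\<Sum>\<alpha>\<in>idx K. \<Sum>\<beta>\<in>idx K. T \<alpha> \<beta> * x \<beta> * y \<alpha>)"
    by (simp add: op_apply_def sum_distrib_right)
  also have "\<dots> = (\<Sum>\<beta>\<in>idx K. \<Sum>\<alpha>\<in>idx K. T \<alpha> \<beta> * x \<beta> * y \<alpha>)"
    by (rule sum.swap)
  also have "\<dots> = (\<Sum>\<alpha>\<in>idx K. x \<alpha> * op_apply K (op_adjoint T) y \<alpha>)"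
    by (simp add: op_apply_def op_adjoint_def sum_distrib_left mult_ac)
  finally show ?thesis .
qed

text \<open>Kronecker product \<open>M\<^sub>1 \<otimes> \<dots> \<otimes> M\<^sub>K\<close> of 2 by 2 matrices.\<close>

definition kron :: "real mat list \<Rightarrow> operator" where
  "kron Ms = (\<lambda>\<alpha> \<beta>. \<Prod>i<length Ms. (Ms ! i) $$ (\<alpha> ! i, \<beta> ! i))"

definition S_mat :: "real mat" where
  "S_mat = mat_of_rows_list 2 [[1, 0], [0, -1]]"

definition A_mat :: "real mat" where
  "A_mat = mat_of_rows_list 2 [[0, 1], [0, 0]]"

definition I_mat :: "real mat" where
  "I_mat = 1\<^sub>m 2"

definition annihilation :: "nat \<Rightarrow> nat \<Rightarrow> operator" where
  "annihilation K i = kron (replicate (i - 1) S_mat @ [A_mat] @ replicate (K - i) I_mat)"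

definition creation :: "nat \<Rightarrow> nat \<Rightarrow> operator" where
  "creation K i = op_adjoint (annihilation K i)"

definition number_op :: "nat \<Rightarrow> operator" where
  "number_op K = (\<lambda>\<alpha> \<beta>. \<Sum>i=1..K. op_mult K (creation K i) (annihilation K i) \<alpha> \<beta>)"

definition number_op_le :: "nat \<Rightarrow> operator" where
  "number_op_le k = (\<lambda>\<alpha> \<beta>. \<Sum>i=1..k.
     kron (replicate (i - 1) I_mat @ [transpose_mat A_mat * A_mat] @ replicate (k - i) I_mat) \<alpha> \<beta>)"

definition number_op_gt :: "nat \<Rightarrow> nat \<Rightarrow> operator" where
  "number_op_gt K k = (\<lambda>\<alpha> \<beta>. \<Sum>i=k+1..K.
     kron (replicate (i - k - 1) I_mat @ [transpose_mat A_mat * A_mat] @ replicate (K - i) I_mat) \<alpha> \<beta>)"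

text \<open>
  For cores \<open>X\<close>, the matrix \<open>X k \<beta>\<close> is \<open>X\<^sub>k\<^sup>{\<^sup>\<beta>\<^sup>}\<close>. Only \<open>X k \<beta>\<close> with \<open>1 \<le> k \<le> K\<close>, \<open>\<beta> \<in> {0,1}\<close>,
  and only \<open>r k\<close> with \<open>k \<le> K\<close> are relevant.
\<close>

type_synonym cores = "nat \<Rightarrow> nat \<Rightarrow> real mat"

definition is_mps :: "nat \<Rightarrow> (nat \<Rightarrow> nat) \<Rightarrow> cores \<Rightarrow> bool" where
  "is_mps K r X \<longleftrightarrow> r 0 = 1 \<and> r K = 1 \<and>
     (\<forall>k\<in>{1..K}. \<forall>\<beta>\<in>{0, 1}. X k \<beta> \<in> carrier_mat (r (k - 1)) (r k))"

text \<open>\<open>core_prod r X k [b\<^sub>1, \<dots>, b\<^sub>l]\<close> is the product of the matrices \<open>X (k+1) b\<^sub>1, \<dots>, X (k+l) b\<^sub>l\<close>.\<close>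

fun core_prod :: "(nat \<Rightarrow> nat) \<Rightarrow> cores \<Rightarrow> nat \<Rightarrow> nat list \<Rightarrow> real mat" where
  "core_prod r X k [] = 1\<^sub>m (r k)"
| "core_prod r X k (b # bs) = X (Suc k) b * core_prod r X (Suc k) bs"

definition tau :: "nat \<Rightarrow> (nat \<Rightarrow> nat) \<Rightarrow> cores \<Rightarrow> tensor" where
  "tau K r X = (\<lambda>\<alpha>. if \<alpha> \<in> idx K then core_prod r X 0 \<alpha> $$ (0, 0) else 0)"

definition tau_le :: "(nat \<Rightarrow> nat) \<Rightarrow> cores \<Rightarrow> nat \<Rightarrow> nat \<Rightarrow> tensor" where
  "tau_le r X k j = (\<lambda>\<alpha>. if \<alpha> \<in> idx k then core_prod r X 0 \<alpha> $$ (0, j) else 0)"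

definition tau_gt :: "nat \<Rightarrow> (nat \<Rightarrow> nat) \<Rightarrow> cores \<Rightarrow> nat \<Rightarrow> nat \<Rightarrow> tensor" where
  "tau_gt K r X k j = (\<lambda>\<alpha>. if \<alpha> \<in> idx (K - k) then core_prod r X k \<alpha> $$ (j, 0) else 0)"

definition mps_rep :: "nat \<Rightarrow> (nat \<Rightarrow> nat) \<Rightarrow> cores \<Rightarrow> tensor \<Rightarrow> bool" where
  "mps_rep K r X x \<longleftrightarrow> is_mps K r X \<and> tau K r X = x"

definition minimal_ranks :: "nat \<Rightarrow> (nat \<Rightarrow> nat) \<Rightarrow> tensor \<Rightarrow> bool" where
  "minimal_ranks K r x \<longleftrightarrow> (\<exists>X. mps_rep K r X x) \<and>
     (\<forall>r' X'. mps_rep K r' X' x \<longrightarrow> (\<forall>k\<in>{1..<K}. r k \<le> r' k))"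

text \<open>The set \<open>\<K>\<^sub>k\<close>; the lower bound is computed in the integers.\<close>

definition particle_range :: "nat \<Rightarrow> nat \<Rightarrow> nat \<Rightarrow> nat set" where
  "particle_range K N k = {n. max 0 (int N - int K + int k) \<le> int n \<and> n \<le> min N k}"

end

theory Submission
  imports Defs "HOL-Library.Function_Algebras"
begin

text \<open>
  The particle number operator is diagonal: it multiplies the entry at \<open>\<alpha>\<close> by the number of ones
  of \<open>\<alpha>\<close>, which is \<open>sum_list \<alpha>\<close>, and so do the truncated operators on their factors
  (\<open>number_op_le_diag\<close>, \<open>number_op_eq_number_op_le\<close>). Hence \<open>x\<close> is an eigenvector for \<open>N\<close> exactly when
  it is supported on lists with \<open>N\<close> ones (\<open>number_op_le_eigen_iff\<close>). The last cut of a block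
  representation carries \<open>x\<close> itself as left partial tensor, so its eigenvalue equation is already the
  one for \<open>x\<close>, and one direction is immediate.

  For the other direction, fix the number \<open>N\<close> of ones. In the \<open>k\<close>-th matricization of \<open>x\<close> the column
  at \<open>\<beta>\<close> is then supported on lists \<open>\<alpha>\<close> with exactly \<open>N - sum_list \<beta>\<close> ones, so it has a definite
  particle number. Choose a basis of the column space among these columns, and give each basis vector
  its particle number as degree. Slicing a basis column of cut \<open>k + 1\<close> at its last index \<open>c\<close> yields a
  column of cut \<open>k\<close>, whose particle number is smaller by \<open>c\<close>, and whose expansion in the basis of cut
  \<open>k\<close> can be taken within that particle number (\<open>span_coefficients_graded\<close>). The expansion
  coefficients are the entries of the new cores (\<open>graded_mps_of_family\<close>). They are nonzero only between
  rank indices whose degrees differ by the occupation of the site, and this is the block structure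
  when \<open>S k n\<close> consists of the indices of degree \<open>n\<close>. The eigenvalue equations follow from the block
  structure, because along every path through the cores the occupations add up to the difference of
  the degrees at its ends (\<open>core_prod_graded\<close>).

  The ranks of the new representation are the column ranks. Minimality of \<open>r\<close> bounds them below by
  \<open>r\<close>, and the given representation bounds them above (\<open>column_set_subset_span\<close>), so the new
  representation has ranks \<open>r\<close>.
\<close>

section \<open>The particle number operators are diagonal\<close>

lemma idx_0: "idx 0 = {[]}"
  by (auto simp: idx_def)

lemma Cons_in_idx_iff: "b # \<alpha> \<in> idx (Suc n) \<longleftrightarrow> b \<in> {0, 1} \<and> \<alpha> \<in> idx n"
  by (auto simp: idx_def)

lemma append_in_idx: "\<alpha> \<in> idx m \<Longrightarrow> \<beta> \<in> idx n \<Longrightarrow> \<alpha> @ \<beta> \<in> idx (m + n)"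
  by (auto simp: idx_def)

lemma length_idx: "\<alpha> \<in> idx n \<Longrightarrow> length \<alpha> = n"
  by (simp add: idx_def)

lemma idx_nth: "\<alpha> \<in> idx n \<Longrightarrow> i < n \<Longrightarrow> \<alpha> ! i = 0 \<or> \<alpha> ! i = 1"
  using nth_mem by (fastforce simp: idx_def)

lemma idx_Suc: "idx (Suc n) = (\<lambda>(b, \<gamma>). b # \<gamma>) ` ({0, 1} \<times> idx n)"
  by (force simp: idx_def length_Suc_conv)

lemma finite_idx: "finite (idx n)"
  by (induction n) (simp_all add: idx_0 idx_Suc)

lemma sum_idx_Suc:
  "(\<Sum>\<alpha>\<in>idx (Suc n). f \<alpha>) = (\<Sum>b\<in>{0, 1}. \<Sum>\<gamma>\<in>idx n. f (b # \<gamma>))"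
proof -
  have "inj_on (\<lambda>(b :: nat, \<gamma>). b # \<gamma>) ({0, 1} \<times> idx n)"
    by (auto simp: inj_on_def)
  then show ?thesis
    by (simp add: idx_Suc sum.reindex sum.cartesian_product split_def)
qed

lemma sum_list_idx_le: "\<alpha> \<in> idx n \<Longrightarrow> sum_list \<alpha> \<le> n"
proof (induction n arbitrary: \<alpha>)
  case (Suc n)
  then obtain b \<gamma> where "\<alpha> = b # \<gamma>" "b \<le> 1" "\<gamma> \<in> idx n"
    by (auto simp: idx_Suc)
  with Suc.IH[of \<gamma>] show ?case by simp
qed (simp add: idx_0)

lemma kron_Cons:
  "kron (M # Ms) (a # \<alpha>) (b # \<beta>) = M $$ (a, b) * kron Ms \<alpha> \<beta>"
  by (simp add: kron_def prod.lessThan_Suc_shift del: prod.lessThan_Suc)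

lemma op_adjoint_kron:
  assumes "set Ms \<subseteq> carrier_mat 2 2" "\<alpha> \<in> idx (length Ms)" "\<beta> \<in> idx (length Ms)"
  shows "op_adjoint (kron Ms) \<alpha> \<beta> = kron (map transpose_mat Ms) \<alpha> \<beta>"
proof -
  have "(Ms ! i) $$ (\<beta> ! i, \<alpha> ! i) = (map transpose_mat Ms ! i) $$ (\<alpha> ! i, \<beta> ! i)"
    if "i < length Ms" for i
  proof -
    have "Ms ! i \<in> carrier_mat 2 2" using assms(1) that by auto
    moreover have "\<alpha> ! i < 2" "\<beta> ! i < 2"
      using idx_nth[OF assms(2) that] idx_nth[OF assms(3) that] by auto
    ultimately show ?thesis using that by simp
  qed
  then show ?thesis
    by (simp add: op_adjoint_def kron_def)
qed

text \<open>
  The mixed-product rule: multiplying out, the sum over all \<open>\<gamma> \<in> {0,1}\<^sup>K\<close> of a product over the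
  sites is the product over the sites of the sums over one bit.
\<close>

lemma op_mult_kron:
  assumes "length Ns = length Ms" "set Ms \<subseteq> carrier_mat 2 2" "set Ns \<subseteq> carrier_mat 2 2"
    "\<alpha> \<in> idx (length Ms)" "\<beta> \<in> idx (length Ms)"
  shows "op_mult (length Ms) (kron Ms) (kron Ns) \<alpha> \<beta> = kron (map2 (*) Ms Ns) \<alpha> \<beta>"
  using assms
proof (induction Ns Ms arbitrary: \<alpha> \<beta> rule: list_induct2)
  case Nil
  then show ?case by (simp add: op_mult_def kron_def idx_0)
next
  case (Cons N Ns M Ms)
  obtain a \<alpha>' b \<beta>' where ab: "\<alpha> = a # \<alpha>'" "\<beta> = b # \<beta>'" "a \<in> {0, 1}" "b \<in> {0, 1}"
    "\<alpha>' \<in> idx (length Ms)" "\<beta>' \<in> idx (length Ms)"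
    using Cons.prems by (auto simp: idx_Suc)
  have MN: "(M * N) $$ (a, b) = (\<Sum>c\<in>{0, 1}. M $$ (a, c) * N $$ (c, b))"
    using Cons.prems ab by (auto simp: scalar_prod_def numeral_2_eq_2)
  have "op_mult (length (M # Ms)) (kron (M # Ms)) (kron (N # Ns)) \<alpha> \<beta>
      = (\<Sum>c\<in>{0, 1}. \<Sum>\<gamma>\<in>idx (length Ms).
          (M $$ (a, c) * N $$ (c, b)) * (kron Ms \<alpha>' \<gamma> * kron Ns \<gamma> \<beta>'))"
    by (simp add: op_mult_def sum_idx_Suc ab kron_Cons mult_ac)
  also have "\<dots> = (M * N) $$ (a, b) * op_mult (length Ms) (kron Ms) (kron Ns) \<alpha>' \<beta>'"
    unfolding MN by (simp add: op_mult_def sum_distrib_left distrib_right sum.distrib)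
  also have "op_mult (length Ms) (kron Ms) (kron Ns) \<alpha>' \<beta>' = kron (map2 (*) Ms Ns) \<alpha>' \<beta>'"
    using Cons.prems ab by (intro Cons.IH) auto
  finally show ?case by (simp add: ab kron_Cons)
qed

lemma carrier_SAI [simp]:
  "S_mat \<in> carrier_mat 2 2" "A_mat \<in> carrier_mat 2 2" "I_mat \<in> carrier_mat 2 2"
  by (simp_all add: S_mat_def A_mat_def I_mat_def mat_of_rows_list_def numeral_2_eq_2)

lemma gram_S: "transpose_mat S_mat * S_mat = I_mat"
  by (rule eq_matI)
    (auto simp: S_mat_def I_mat_def mat_of_rows_list_def scalar_prod_def less_Suc_eq numeral_2_eq_2)

lemma gram_I: "transpose_mat I_mat * I_mat = I_mat"
  by (simp add: I_mat_def)

lemma index_gram_A: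
  "a < 2 \<Longrightarrow> b < 2 \<Longrightarrow> (transpose_mat A_mat * A_mat) $$ (a, b) = (if a = b then real a else 0)"
  by (auto simp: A_mat_def mat_of_rows_list_def scalar_prod_def less_Suc_eq numeral_2_eq_2)

text \<open>
  Since the sign matrices square to the identity, the signs in the annihilation operators cancel
  in \<open>a\<^sub>i\<^sup>* a\<^sub>i\<close>.
\<close>

lemma number_op_eq_number_op_le:
  assumes "\<alpha> \<in> idx K" "\<beta> \<in> idx K"
  shows "number_op K \<alpha> \<beta> = number_op_le K \<alpha> \<beta>"
  unfolding number_op_def number_op_le_def
proof (rule sum.cong[OF refl])
  fix i assume i: "i \<in> {1..K}"
  let ?Ms = "replicate (i - 1) S_mat @ [A_mat] @ replicate (K - i) I_mat"
  have len: "length ?Ms = K" using i by simp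
  have carr: "set ?Ms \<subseteq> carrier_mat 2 2" by auto
  have "op_mult K (creation K i) (annihilation K i) \<alpha> \<beta>
      = (\<Sum>\<gamma>\<in>idx K. op_adjoint (kron ?Ms) \<alpha> \<gamma> * kron ?Ms \<gamma> \<beta>)"
    by (simp add: op_mult_def creation_def annihilation_def)
  also have "\<dots> = op_mult K (kron (map transpose_mat ?Ms)) (kron ?Ms) \<alpha> \<beta>"
    unfolding op_mult_def
    by (intro sum.cong refl arg_cong2[of _ _ _ _ "(*)"] op_adjoint_kron carr)
      (simp_all only: len assms)
  also have "\<dots> = kron (map2 (*) (map transpose_mat ?Ms) ?Ms) \<alpha> \<beta>"
  proof -
    have "op_mult (length (map transpose_mat ?Ms)) (kron (map transpose_mat ?Ms)) (kron ?Ms) \<alpha> \<beta>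
        = kron (map2 (*) (map transpose_mat ?Ms) ?Ms) \<alpha> \<beta>"
      by (rule op_mult_kron) (use carr in \<open>auto simp only: length_map len assms set_map transpose_carrier_mat\<close>)
    then show ?thesis by (simp only: length_map len)
  qed
  also have "map2 (*) (map transpose_mat ?Ms) ?Ms
      = replicate (i - 1) I_mat @ [transpose_mat A_mat * A_mat] @ replicate (K - i) I_mat"
    by (simp add: zip_append zip_replicate gram_S gram_I)
  finally show "op_mult K (creation K i) (annihilation K i) \<alpha> \<beta> =
      kron (replicate (i - 1) I_mat @ [transpose_mat A_mat * A_mat] @ replicate (K - i) I_mat) \<alpha> \<beta>" .
qed

lemma kron_occupation:
  assumes "\<alpha> \<in> idx (p + 1 + q)" "\<beta> \<in> idx (p + 1 + q)"
  shows "kron (replicate p I_mat @ [transpose_mat A_mat * A_mat] @ replicate q I_mat) \<alpha> \<beta>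
    = (if \<alpha> = \<beta> then real (\<alpha> ! p) else 0)" (is "kron ?Ms \<alpha> \<beta> = _")
proof -
  have entry: "(?Ms ! i) $$ (\<alpha> ! i, \<beta> ! i)
      = (if \<alpha> ! i = \<beta> ! i then if i = p then real (\<alpha> ! p) else 1 else 0)"
    if "i < p + 1 + q" for i
    using that idx_nth[OF assms(1) that] idx_nth[OF assms(2) that]
    by (auto simp: nth_append nth_Cons' I_mat_def index_gram_A simp del: index_mult_mat)
  have "kron ?Ms \<alpha> \<beta> = (\<Prod>i<p + 1 + q.
      if \<alpha> ! i = \<beta> ! i then if i = p then real (\<alpha> ! p) else 1 else 0)"
    unfolding kron_def by (intro prod.cong) (auto simp: entry simp del: append.simps)
  also have "\<dots> = (if \<alpha> = \<beta> then real (\<alpha> ! p) else 0)"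
  proof (cases "\<alpha> = \<beta>")
    case False
    then obtain i where "i < p + 1 + q" "\<alpha> ! i \<noteq> \<beta> ! i"
      using assms by (metis length_idx nth_equalityI)
    then have "(\<Prod>i<p + 1 + q.
        if \<alpha> ! i = \<beta> ! i then if i = p then real (\<alpha> ! p) else 1 else 0) = 0"
      by (intro prod_zero[OF finite_lessThan] bexI[of _ i]) auto
    with False show ?thesis by simp
  qed simp
  finally show ?thesis .
qed

lemma number_op_le_diag:
  assumes "\<alpha> \<in> idx k" "\<beta> \<in> idx k"
  shows "number_op_le k \<alpha> \<beta> = (if \<alpha> = \<beta> then real (sum_list \<alpha>) else 0)"
proof -
  have "number_op_le k \<alpha> \<beta> = (\<Sum>i=1..k. if \<alpha> = \<beta> then real (\<alpha> ! (i - 1)) else 0)"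
    unfolding number_op_le_def
  proof (rule sum.cong[OF refl])
    fix i assume "i \<in> {1..k}"
    then have "k = (i - 1) + 1 + (k - i)" by auto
    with assms have "\<alpha> \<in> idx ((i - 1) + 1 + (k - i))" "\<beta> \<in> idx ((i - 1) + 1 + (k - i))" by auto
    then show "kron (replicate (i - 1) I_mat @ [transpose_mat A_mat * A_mat] @ replicate (k - i) I_mat) \<alpha> \<beta>
      = (if \<alpha> = \<beta> then real (\<alpha> ! (i - 1)) else 0)" by (rule kron_occupation)
  qed
  also have "\<dots> = (if \<alpha> = \<beta> then (\<Sum>i<k. real (\<alpha> ! i)) else 0)"
    by (simp add: sum.atLeast1_atMost_eq)
  also have "\<dots> = (if \<alpha> = \<beta> then real (sum_list \<alpha>) else 0)"
    by (simp add: sum_list_sum_nth atLeast0LessThan flip: length_idx[OF assms(1)])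
  finally show ?thesis .
qed

lemma number_op_gt_eq_number_op_le:
  assumes "k \<le> K"
  shows "number_op_gt K k = number_op_le (K - k)"
proof -
  have *: "(\<Sum>i=k + 1..K. f i) = (\<Sum>i=1..K - k. f (i + k))" for f :: "nat \<Rightarrow> real"
    using assms sum.shift_bounds_cl_nat_ivl[of f 1 k "K - k"] by (simp add: add.commute)
  have "i + k - k - 1 = i - 1" "K - (i + k) = K - k - i" for i
    by auto
  then show ?thesis
    unfolding number_op_gt_def number_op_le_def * by simp
qed

lemma number_op_le_eigen_iff:
  assumes "y \<in> fock k"
  shows "op_apply k (number_op_le k) y = (\<lambda>\<alpha>. c * y \<alpha>) \<longleftrightarrow>
    (\<forall>\<alpha>. y \<alpha> \<noteq> 0 \<longrightarrow> real (sum_list \<alpha>) = c)"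
proof -
  have "op_apply k (number_op_le k) y \<alpha> = real (sum_list \<alpha>) * y \<alpha>" for \<alpha>
  proof (cases "\<alpha> \<in> idx k")
    case True
    then have "op_apply k (number_op_le k) y \<alpha>
        = (\<Sum>\<beta>\<in>idx k. if \<alpha> = \<beta> then real (sum_list \<alpha>) * y \<beta> else 0)"
      unfolding op_apply_def by (auto intro!: sum.cong simp: number_op_le_diag)
    then show ?thesis using True finite_idx by simp
  next
    case False
    then show ?thesis using assms by (simp add: op_apply_def fock_def)
  qed
  then show ?thesis by (auto simp: fun_eq_iff)
qed

lemma number_op_apply_eq: "op_apply K (number_op K) y = op_apply K (number_op_le K) y"
  by (auto simp: op_apply_def fun_eq_iff number_op_eq_number_op_le intro!: sum.cong)

section \<open>Products of cores\<close>

lemma core_prod_carrier: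
  assumes "is_mps K r X" "\<alpha> \<in> idx l" "k + l \<le> K"
  shows "core_prod r X k \<alpha> \<in> carrier_mat (r k) (r (k + l))"
  using assms(2,3)
proof (induction l arbitrary: k \<alpha>)
  case (Suc l)
  then obtain b \<gamma> where \<alpha>: "\<alpha> = b # \<gamma>" "b \<in> {0, 1}" "\<gamma> \<in> idx l" by (auto simp: idx_Suc)
  have "Suc k \<in> {1..K}" using Suc.prems by auto
  then have "X (Suc k) b \<in> carrier_mat (r (Suc k - 1)) (r (Suc k))"
    using assms(1) \<alpha>(2) unfolding is_mps_def by blast
  moreover have "core_prod r X (Suc k) \<gamma> \<in> carrier_mat (r (Suc k)) (r (Suc k + l))"
    using Suc.prems \<alpha> by (intro Suc.IH) auto
  ultimately show ?case by (auto simp: \<alpha>)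
qed (simp add: idx_0)

lemma core_prod_append:
  assumes "is_mps K r X" "\<alpha> \<in> idx l" "\<beta> \<in> idx m" "k + l + m \<le> K"
  shows "core_prod r X k (\<alpha> @ \<beta>) = core_prod r X k \<alpha> * core_prod r X (k + l) \<beta>"
  using assms(2,4)
proof (induction l arbitrary: k \<alpha>)
  case 0
  have "core_prod r X k \<beta> \<in> carrier_mat (r k) (r (k + m))"
    using core_prod_carrier[OF assms(1,3)] 0 by simp
  then show ?case using 0 by (simp add: idx_0)
next
  case (Suc l)
  then obtain b \<gamma> where \<alpha>: "\<alpha> = b # \<gamma>" "b \<in> {0, 1}" "\<gamma> \<in> idx l" by (auto simp: idx_Suc)
  have "Suc k \<in> {1..K}" using Suc.prems by auto
  then have X: "X (Suc k) b \<in> carrier_mat (r k) (r (Suc k))"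
    using assms(1) \<alpha>(2) unfolding is_mps_def by fastforce
  have \<gamma>: "core_prod r X (Suc k) \<gamma> \<in> carrier_mat (r (Suc k)) (r (Suc k + l))"
    using Suc.prems \<alpha> by (intro core_prod_carrier[OF assms(1)]) auto
  have \<beta>: "core_prod r X (Suc k + l) \<beta> \<in> carrier_mat (r (Suc k + l)) (r (Suc k + l + m))"
    using Suc.prems by (intro core_prod_carrier[OF assms(1,3)]) auto
  have "core_prod r X (Suc k) (\<gamma> @ \<beta>) = core_prod r X (Suc k) \<gamma> * core_prod r X (Suc k + l) \<beta>"
    using Suc.prems \<alpha> by (intro Suc.IH) auto
  then show ?case using assoc_mult_mat[OF X \<gamma> \<beta>] by (simp add: \<alpha>)
qed

lemma core_prod_append_entry:
  assumes "is_mps K r X" "\<alpha> \<in> idx l" "\<beta> \<in> idx m" "k + l + m \<le> K" "i < r k" "j < r (k + l + m)"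
  shows "core_prod r X k (\<alpha> @ \<beta>) $$ (i, j)
    = (\<Sum>s<r (k + l). core_prod r X k \<alpha> $$ (i, s) * core_prod r X (k + l) \<beta> $$ (s, j))"
proof -
  have "core_prod r X k \<alpha> \<in> carrier_mat (r k) (r (k + l))"
    using assms by (intro core_prod_carrier) auto
  moreover have "core_prod r X (k + l) \<beta> \<in> carrier_mat (r (k + l)) (r (k + l + m))"
    using assms by (intro core_prod_carrier) auto
  ultimately show ?thesis
    using assms(5,6) unfolding core_prod_append[OF assms(1-4)]
    by (auto simp: scalar_prod_def atLeast0LessThan)
qed

text \<open>
  An entry of a product of cores is a sum over paths of rank indices. On a path with nonzero weight
  the degree \<open>d\<close> rises at every site by the occupation of that site, and these increments telescope.
  Both eigenvalue equations come from this: paths from the left end give the one for the left partial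
  tensors, paths to the right end the one for the right partial tensors.
\<close>

lemma core_prod_graded:
  assumes "is_mps K r Y"
    and graded: "\<And>k c i j. k < K \<Longrightarrow> c \<in> {0, 1} \<Longrightarrow> i < r k \<Longrightarrow> j < r (Suc k) \<Longrightarrow>
      Y (Suc k) c $$ (i, j) \<noteq> 0 \<Longrightarrow> d k i + c = d (Suc k) j"
    and "\<alpha> \<in> idx l" "k + l \<le> K" "i < r k" "j < r (k + l)" "core_prod r Y k \<alpha> $$ (i, j) \<noteq> 0"
  shows "d k i + sum_list \<alpha> = (d (k + l) j :: nat)"
  using assms(3-)
proof (induction l arbitrary: k \<alpha> i)
  case 0
  then show ?case by (auto simp: idx_0 split: if_splits)
next
  case (Suc l)
  then obtain b \<gamma> where \<alpha>: "\<alpha> = b # \<gamma>" "b \<in> {0, 1}" "\<gamma> \<in> idx l" by (auto simp: idx_Suc)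
  have "Suc k \<in> {1..K}" using Suc.prems by auto
  then have Y: "Y (Suc k) b \<in> carrier_mat (r k) (r (Suc k))"
    using assms(1) \<alpha>(2) unfolding is_mps_def by fastforce
  have C: "core_prod r Y (Suc k) \<gamma> \<in> carrier_mat (r (Suc k)) (r (Suc k + l))"
    using Suc.prems \<alpha> by (intro core_prod_carrier[OF assms(1)]) auto
  have "core_prod r Y k \<alpha> $$ (i, j)
      = (\<Sum>s<r (Suc k). Y (Suc k) b $$ (i, s) * core_prod r Y (Suc k) \<gamma> $$ (s, j))"
    using Y C Suc.prems(3,4) by (auto simp: \<alpha>(1) scalar_prod_def atLeast0LessThan)
  with Suc.prems(5) obtain s where s: "s < r (Suc k)" "Y (Suc k) b $$ (i, s) \<noteq> 0"
    "core_prod r Y (Suc k) \<gamma> $$ (s, j) \<noteq> 0"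
    by (metis (no_types, lifting) lessThan_iff mult_eq_0_iff sum.neutral)
  have "d k i + b = d (Suc k) s"
    using graded[of k b i s] s \<alpha>(2) Suc.prems by auto
  moreover have "d (Suc k) s + sum_list \<gamma> = d (Suc k + l) j"
    using Suc.prems \<alpha> s by (intro Suc.IH) auto
  ultimately show ?case by (simp add: \<alpha>(1))
qed

section \<open>Cores from graded bases\<close>

text \<open>
  Multiplying a prefix product by one more core is the expansion of the slices of \<open>f (k + 1)\<close> at its
  last index in terms of \<open>f k\<close>, with the entries of the core as coefficients.
\<close>

lemma core_prod_eq_family:
  assumes "is_mps K r Y"
    and start: "f 0 0 [] = 1"
    and step: "\<And>k c j \<alpha>. k < K \<Longrightarrow> c \<in> {0, 1} \<Longrightarrow> j < r (Suc k) \<Longrightarrow> \<alpha> \<in> idx k \<Longrightarrow>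
      f (Suc k) j (\<alpha> @ [c]) = (\<Sum>i<r k. f k i \<alpha> * Y (Suc k) c $$ (i, j))"
    and "\<alpha> \<in> idx k" "k \<le> K" "j < r k"
  shows "core_prod r Y 0 \<alpha> $$ (0, j) = f k j \<alpha>"
  using assms(4-)
proof (induction k arbitrary: \<alpha> j)
  case 0
  then show ?case using assms(1) start by (auto simp: idx_0 is_mps_def)
next
  case (Suc k)
  obtain \<gamma> c where \<alpha>: "\<alpha> = \<gamma> @ [c]" "\<gamma> \<in> idx k" "c \<in> {0, 1}"
    using Suc.prems(1) by (cases \<alpha> rule: rev_cases) (auto simp: idx_def)
  have c: "[c] \<in> idx 1" using \<alpha>(3) by (auto simp: idx_def)
  have "Suc k \<in> {1..K}" using Suc.prems by auto
  then have Y: "Y (Suc k) c \<in> carrier_mat (r k) (r (Suc k))"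
    using assms(1) \<alpha>(3) unfolding is_mps_def by fastforce
  have "core_prod r Y 0 \<alpha> $$ (0, j)
      = (\<Sum>s<r k. core_prod r Y 0 \<gamma> $$ (0, s) * core_prod r Y k [c] $$ (s, j))"
    using core_prod_append_entry[OF assms(1) \<alpha>(2) c, of 0 0 j] Suc.prems assms(1)
    by (simp add: \<alpha>(1) is_mps_def)
  also have "\<dots> = (\<Sum>s<r k. f k s \<gamma> * Y (Suc k) c $$ (s, j))"
    using Suc.prems \<alpha> Y by (intro sum.cong) (auto simp: Suc.IH)
  also have "\<dots> = f (Suc k) j \<alpha>"
    using step[of k c j \<gamma>] Suc.prems \<alpha> by simp
  finally show ?case .
qed

lemma graded_mps_of_family:
  assumes r: "r 0 = 1" "r K = 1" and "0 < K" and x: "x \<in> fock K"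
    and start: "f 0 0 [] = 1" and target: "f K 0 = x"
    and refine: "\<And>k c j. k < K \<Longrightarrow> c \<in> {0, 1} \<Longrightarrow> j < r (Suc k) \<Longrightarrow>
      \<exists>w. (\<forall>i<r k. w i \<noteq> 0 \<longrightarrow> d k i + c = d (Suc k) j) \<and>
          (\<forall>\<alpha>\<in>idx k. f (Suc k) j (\<alpha> @ [c]) = (\<Sum>i<r k. f k i \<alpha> * w i))"
  obtains Y where "mps_rep K r Y x"
    and "\<And>k c i j. k < K \<Longrightarrow> c \<in> {0, 1} \<Longrightarrow> i < r k \<Longrightarrow> j < r (Suc k) \<Longrightarrow>
      Y (Suc k) c $$ (i, j) \<noteq> 0 \<Longrightarrow> d k i + c = (d (Suc k) j :: nat)"
proof -
  define coeffs where "coeffs k c j u \<longleftrightarrow> (\<forall>i<r k. u i \<noteq> 0 \<longrightarrow> d k i + c = d (Suc k) j) \<and>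
      (\<forall>\<alpha>\<in>idx k. f (Suc k) j (\<alpha> @ [c]) = (\<Sum>i<r k. f k i \<alpha> * u i))" for k c j u
  define w where "w k c j = (SOME u. coeffs k c j u)" for k c j
  have "coeffs k c j (w k c j)" if "k < K" "c \<in> {0, 1}" "j < r (Suc k)" for k c j
  proof -
    have "\<exists>u. coeffs k c j u" unfolding coeffs_def by (rule refine[OF that])
    then show ?thesis unfolding w_def by (rule someI_ex)
  qed
  then have w: "(\<forall>i<r k. w k c j i \<noteq> 0 \<longrightarrow> d k i + c = d (Suc k) j) \<and>
      (\<forall>\<alpha>\<in>idx k. f (Suc k) j (\<alpha> @ [c]) = (\<Sum>i<r k. f k i \<alpha> * w k c j i))"
    if "k < K" "c \<in> {0, 1}" "j < r (Suc k)" for k c j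
    using that unfolding coeffs_def by blast
  define Y where "Y = (\<lambda>k c. mat (r (k - 1)) (r k) (\<lambda>(i, j). w (k - 1) c j i))"
  have Y: "Y (Suc k) c $$ (i, j) = w k c j i" if "i < r k" "j < r (Suc k)" for k c i j
    using that by (simp add: Y_def)
  have mps: "is_mps K r Y"
    using r by (auto simp: is_mps_def Y_def)
  have "tau K r Y = x"
  proof
    fix \<alpha>
    show "tau K r Y \<alpha> = x \<alpha>"
    proof (cases "\<alpha> \<in> idx K")
      case True
      have "core_prod r Y 0 \<alpha> $$ (0, 0) = f K 0 \<alpha>"
        by (rule core_prod_eq_family[where K = K]) (use mps start w True r in \<open>auto simp: Y\<close>)
      then show ?thesis using True target by (simp add: tau_def)
    next
      case False
      then show ?thesis using x by (simp add: tau_def fock_def)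
    qed
  qed
  with mps have "mps_rep K r Y x" by (simp add: mps_rep_def)
  then show thesis by (rule that) (use w in \<open>auto simp: Y\<close>)
qed

section \<open>Bases of the column spaces of the matricizations\<close>

interpretation tensors: vector_space "\<lambda>c (v :: tensor) \<alpha>. c * v \<alpha>"
  by unfold_locales (simp_all add: fun_eq_iff algebra_simps)

definition matricization_column :: "tensor \<Rightarrow> nat \<Rightarrow> nat list \<Rightarrow> tensor" where
  "matricization_column x k \<beta> = (\<lambda>\<alpha>. if \<alpha> \<in> idx k then x (\<alpha> @ \<beta>) else 0)"

definition column_set :: "nat \<Rightarrow> tensor \<Rightarrow> nat \<Rightarrow> tensor set" where
  "column_set K x k = matricization_column x k ` idx (K - k)"

lemma sum_tensor_apply: "(\<Sum>i\<in>I. g i) \<alpha> = (\<Sum>i\<in>I. (g i :: tensor) \<alpha>)"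
  by (induction I rule: infinite_finite_induct) auto

text \<open>
  The representation exhibits every column of the \<open>k\<close>-th matricization as a combination of the
  \<open>r k\<close> left partial tensors, so the column rank is at most \<open>r k\<close>.
\<close>

lemma column_set_subset_span:
  assumes rep: "mps_rep K r X x" and "k \<le> K"
  shows "column_set K x k \<subseteq> tensors.span (tau_le r X k ` {..<r k})"
proof
  fix v assume "v \<in> column_set K x k"
  then obtain \<beta> where \<beta>: "\<beta> \<in> idx (K - k)" "v = matricization_column x k \<beta>"
    by (auto simp: column_set_def)
  have mps: "is_mps K r X" and x: "tau K r X = x" using rep by (auto simp: mps_rep_def)
  have "v = (\<Sum>j<r k. (\<lambda>\<alpha>. core_prod r X k \<beta> $$ (j, 0) * tau_le r X k j \<alpha>))"
  proof
    fix \<alpha>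
    show "v \<alpha> = (\<Sum>j<r k. (\<lambda>\<alpha>. core_prod r X k \<beta> $$ (j, 0) * tau_le r X k j \<alpha>)) \<alpha>"
    proof (cases "\<alpha> \<in> idx k")
      case True
      then have "\<alpha> @ \<beta> \<in> idx K"
        using append_in_idx[OF True \<beta>(1)] \<open>k \<le> K\<close> by simp
      then have "v \<alpha> = core_prod r X 0 (\<alpha> @ \<beta>) $$ (0, 0)"
        using True \<beta>(2) by (simp add: matricization_column_def tau_def flip: x)
      also have "\<dots> = (\<Sum>j<r k. core_prod r X 0 \<alpha> $$ (0, j) * core_prod r X k \<beta> $$ (j, 0))"
        using core_prod_append_entry[OF mps True \<beta>(1), of 0 0 0] \<open>k \<le> K\<close> mps
        by (simp add: is_mps_def)
      finally show ?thesis
        using True by (simp add: sum_tensor_apply tau_le_def mult.commute)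
    qed (simp add: \<beta>(2) matricization_column_def sum_tensor_apply tau_le_def)
  qed
  also have "\<dots> \<in> tensors.span (tau_le r X k ` {..<r k})"
    by (rule tensors.span_sum, rule tensors.span_scale, rule tensors.span_base) simp
  finally show "v \<in> tensors.span (tau_le r X k ` {..<r k})" .
qed

lemma column_basis_exists:
  assumes rep: "mps_rep K r X x" and "k \<le> K"
  obtains B where "finite B" "card B \<le> r k" "0 \<notin> B" "B \<subseteq> column_set K x k"
    "column_set K x k \<subseteq> tensors.span B"
proof -
  obtain B where B: "B \<subseteq> column_set K x k" "tensors.independent B"
    "column_set K x k \<subseteq> tensors.span B"
    by (rule tensors.maximal_independent_subset)
  let ?T = "tau_le r X k ` {..<r k}"
  have "finite B \<and> card B \<le> card ?T"
    by (rule tensors.independent_span_bound)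
      (use B column_set_subset_span[OF assms] in auto)
  moreover have "card ?T \<le> r k"
    using card_image_le[of "{..<r k}" "tau_le r X k"] by simp
  moreover have "0 \<notin> B"
    using B(2) tensors.dependent_zero by blast
  ultimately show thesis using that B by auto
qed

text \<open>
  At the two ends of the chain a particular basis is prescribed: on the left the unit of the scalars,
  which makes the empty product of cores equal to one, and on the right \<open>x\<close> itself.
\<close>

definition unit_tensor :: tensor where
  "unit_tensor \<alpha> = (if \<alpha> = [] then 1 else 0)"

lemma normalized_column_basis_exists:
  assumes rep: "mps_rep K r X x" and x: "x \<in> fock K" "x \<noteq> (\<lambda>_. 0)" and "0 < K" "k \<le> K"
  obtains B where "finite B" "card B \<le> r k" "0 \<notin> B" "0 < k \<Longrightarrow> B \<subseteq> column_set K x k"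
    "column_set K x k \<subseteq> tensors.span B" "k = 0 \<Longrightarrow> B = {unit_tensor}" "k = K \<Longrightarrow> B = {x}"
proof -
  have r: "r 0 = 1" "r K = 1" using rep by (auto simp: mps_rep_def is_mps_def)
  consider "k = 0" | "k = K" | "0 < k" "k < K" using \<open>k \<le> K\<close> by linarith
  then show thesis
  proof cases
    case 1
    have "matricization_column x 0 \<beta> = (\<lambda>\<alpha>. x \<beta> * unit_tensor \<alpha>)" for \<beta>
      by (auto simp: matricization_column_def idx_0 unit_tensor_def)
    moreover have "(\<lambda>\<alpha>. c * unit_tensor \<alpha>) \<in> tensors.span {unit_tensor}" for c
      by (rule tensors.span_scale, rule tensors.span_base) simp
    ultimately have "column_set K x 0 \<subseteq> tensors.span {unit_tensor}"
      unfolding column_set_def by auto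
    moreover have "unit_tensor \<noteq> 0" by (auto simp: unit_tensor_def fun_eq_iff)
    ultimately show thesis using 1 \<open>0 < K\<close> r by (intro that[of "{unit_tensor}"]) auto
  next
    case 2
    have "column_set K x K = {x}"
      using x(1) by (auto simp: column_set_def matricization_column_def idx_0 fock_def)
    moreover have "x \<noteq> 0" using x(2) by (simp add: zero_fun_def)
    ultimately show thesis
      using 2 \<open>0 < K\<close> r by (intro that[of "{x}"]) (auto intro: tensors.span_base)
  next
    case 3
    then show thesis using column_basis_exists[OF rep \<open>k \<le> K\<close>] that by (metis less_irrefl)
  qed
qed

text \<open>
  Let \<open>v\<close> be supported on the particle numbers satisfying \<open>P\<close>, and let every basis vector \<open>e i\<close> be
  supported on a single particle number \<open>d i\<close>. Restricting a linear combination to the particle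
  numbers satisfying \<open>P\<close> deletes the terms with \<open>\<not> P (d i)\<close> and leaves the others unchanged.
\<close>

lemma span_coefficients_graded:
  assumes "v \<in> tensors.span B" and e: "bij_betw e {..<m :: nat} B"
    and v: "\<And>\<alpha>. v \<alpha> \<noteq> 0 \<Longrightarrow> P (sum_list \<alpha>)"
    and d: "\<And>i \<alpha>. i < m \<Longrightarrow> e i \<alpha> \<noteq> 0 \<Longrightarrow> sum_list \<alpha> = d i"
  shows "\<exists>w. (\<forall>i<m. w i \<noteq> 0 \<longrightarrow> P (d i)) \<and> (\<forall>\<alpha>. v \<alpha> = (\<Sum>i<m. e i \<alpha> * w i))"
proof -
  have "finite B" using e bij_betw_finite by blast
  then obtain u where u: "v = (\<Sum>b\<in>B. (\<lambda>\<alpha>. u b * b \<alpha>))"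
    using assms(1) by (auto simp: tensors.span_finite)
  have v_sum: "v \<alpha> = (\<Sum>i<m. e i \<alpha> * u (e i))" for \<alpha>
    by (simp add: u sum_tensor_apply mult.commute sum.reindex_bij_betw[OF e, symmetric])
  define w where "w i = (if P (d i) then u (e i) else 0)" for i
  have "v \<alpha> = (\<Sum>i<m. e i \<alpha> * w i)" for \<alpha>
  proof (cases "P (sum_list \<alpha>)")
    case True
    have "e i \<alpha> * u (e i) = e i \<alpha> * w i" if "i < m" for i
      using d[OF that, of \<alpha>] True by (cases "e i \<alpha> = 0") (simp_all add: w_def)
    then show ?thesis unfolding v_sum by (intro sum.cong) auto
  next
    case False
    then have "e i \<alpha> * w i = 0" if "i < m" for i
      using d[OF that, of \<alpha>] by (cases "e i \<alpha> = 0") (auto simp: w_def)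
    then have "(\<Sum>i<m. e i \<alpha> * w i) = 0" by (intro sum.neutral) auto
    moreover have "v \<alpha> = 0" using v False by blast
    ultimately show ?thesis by simp
  qed
  then show ?thesis by (intro exI[of _ w]) (simp add: w_def)
qed

section \<open>Graded representations of minimal rank\<close>

text \<open>
  If every index list in the support of \<open>x\<close> has \<open>N\<close> ones, then the column \<open>\<alpha> \<mapsto> x (\<alpha> @ \<beta>)\<close> only
  sees lists \<open>\<alpha>\<close> with \<open>N\<close> minus the number of ones of \<open>\<beta>\<close>; neither number exceeds the length of its
  list, which gives the two bounds of the particle range.
\<close>

lemma column_homogeneous:
  assumes supp: "\<And>\<alpha>. x \<alpha> \<noteq> 0 \<Longrightarrow> sum_list \<alpha> = N"
    and "k \<le> K" "v \<in> column_set K x k" "v \<noteq> 0"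
  shows "\<exists>n\<in>particle_range K N k. \<forall>\<alpha>. v \<alpha> \<noteq> 0 \<longrightarrow> sum_list \<alpha> = n"
proof -
  obtain \<beta> where \<beta>: "\<beta> \<in> idx (K - k)" "v = matricization_column x k \<beta>"
    using assms(3) by (auto simp: column_set_def)
  have *: "\<alpha> \<in> idx k \<and> sum_list \<alpha> + sum_list \<beta> = N" if "v \<alpha> \<noteq> 0" for \<alpha>
    using that supp[of "\<alpha> @ \<beta>"] by (auto simp: \<beta>(2) matricization_column_def split: if_splits)
  obtain \<alpha> where \<alpha>: "v \<alpha> \<noteq> 0" using assms(4) by (auto simp: fun_eq_iff)
  have "sum_list \<alpha> \<in> particle_range K N k"
    using *[OF \<alpha>] sum_list_idx_le[of \<alpha> k] sum_list_idx_le[OF \<beta>(1)] \<open>k \<le> K\<close>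
    by (auto simp: particle_range_def)
  moreover have "sum_list \<gamma> = sum_list \<alpha>" if "v \<gamma> \<noteq> 0" for \<gamma>
    using *[OF \<alpha>] *[OF that] by simp
  ultimately show ?thesis by blast
qed

lemma column_slice:
  assumes "c \<in> {0, 1}" "\<alpha> \<in> idx k"
  shows "matricization_column x (Suc k) \<beta> (\<alpha> @ [c]) = matricization_column x k (c # \<beta>) \<alpha>"
proof -
  have "[c] \<in> idx 1" using assms(1) by (auto simp: idx_def)
  then have "\<alpha> @ [c] \<in> idx (Suc k)" using append_in_idx[OF assms(2)] by fastforce
  then show ?thesis using assms(2) by (simp add: matricization_column_def)
qed

text \<open>
  Fix a basis of columns for every cut. The slice of a basis column of cut \<open>k + 1\<close> at its last index
  is a column of cut \<open>k\<close>, so the bases form a family to which the construction of cores applies,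
  with the particle number as degree. The ranks so obtained are the column ranks. These are at most
  \<open>r k\<close> because \<open>X\<close> represents \<open>x\<close>, and at least \<open>r k\<close> because \<open>r\<close> is minimal.
\<close>

lemma graded_representation_of_minimal_rank:
  assumes x: "x \<in> fock K" "x \<noteq> (\<lambda>_. 0)"
    and rep: "mps_rep K r X x" and min: "minimal_ranks K r x"
    and supp: "\<And>\<alpha>. x \<alpha> \<noteq> 0 \<Longrightarrow> sum_list \<alpha> = N" and "0 < K" "N \<le> K"
  obtains Y d where "mps_rep K r Y x"
    "\<And>k c i j. k < K \<Longrightarrow> c \<in> {0, 1} \<Longrightarrow> i < r k \<Longrightarrow> j < r (Suc k) \<Longrightarrow>
      Y (Suc k) c $$ (i, j) \<noteq> 0 \<Longrightarrow> d k i + c = d (Suc k) j"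
    "\<And>k j. k \<le> K \<Longrightarrow> j < r k \<Longrightarrow> d k j \<in> particle_range K N k"
    "d 0 0 = 0" "d K 0 = N"
proof -
  have "\<exists>B. finite B \<and> card B \<le> r k \<and> 0 \<notin> B \<and> (0 < k \<longrightarrow> B \<subseteq> column_set K x k) \<and>
      column_set K x k \<subseteq> tensors.span B \<and> (k = 0 \<longrightarrow> B = {unit_tensor}) \<and> (k = K \<longrightarrow> B = {x})"
    if "k \<le> K" for k
    using normalized_column_basis_exists[OF rep x \<open>0 < K\<close> that] by metis
  then obtain B where "\<forall>k\<le>K. finite (B k) \<and> card (B k) \<le> r k \<and> 0 \<notin> B k \<and>
      (0 < k \<longrightarrow> B k \<subseteq> column_set K x k) \<and> column_set K x k \<subseteq> tensors.span (B k) \<and>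
      (k = 0 \<longrightarrow> B k = {unit_tensor}) \<and> (k = K \<longrightarrow> B k = {x})"
    by metis
  then have fin: "\<And>k. k \<le> K \<Longrightarrow> finite (B k)" and card_le: "\<And>k. k \<le> K \<Longrightarrow> card (B k) \<le> r k"
    and nz: "\<And>k. k \<le> K \<Longrightarrow> 0 \<notin> B k"
    and sub: "\<And>k. k < K \<Longrightarrow> B (Suc k) \<subseteq> column_set K x (Suc k)"
    and span: "\<And>k. k \<le> K \<Longrightarrow> column_set K x k \<subseteq> tensors.span (B k)"
    and B0: "B 0 = {unit_tensor}" and BK: "B K = {x}"
    by auto
  have "\<exists>n\<in>particle_range K N k. \<forall>\<alpha>. v \<alpha> \<noteq> 0 \<longrightarrow> sum_list \<alpha> = n" if "k \<le> K" "v \<in> B k" for k v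
  proof (cases k)
    case 0
    with that B0 \<open>N \<le> K\<close> show ?thesis
      by (auto simp: unit_tensor_def particle_range_def)
  next
    case (Suc l)
    have "v \<noteq> 0" using nz that by blast
    with that Suc sub[of l] show ?thesis by (intro column_homogeneous supp) auto
  qed
  then obtain deg where deg_range: "k \<le> K \<Longrightarrow> v \<in> B k \<Longrightarrow> deg k v \<in> particle_range K N k"
    and deg: "k \<le> K \<Longrightarrow> v \<in> B k \<Longrightarrow> v \<alpha> \<noteq> 0 \<Longrightarrow> sum_list \<alpha> = deg k v" for k v \<alpha>
    by metis
  have "\<forall>k\<le>K. \<exists>e. bij_betw e {..<card (B k)} (B k)"
    using fin ex_bij_betw_nat_finite by (metis atLeast0LessThan)
  then obtain e where e: "k \<le> K \<Longrightarrow> bij_betw (e k) {..<card (B k)} (B k)" for k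
    by metis
  have eB: "e k j \<in> B k" if "k \<le> K" "j < card (B k)" for k j
    using e[OF that(1)] that(2) bij_betwE by fastforce
  define d where "d k j = deg k (e k j)" for k j
  have e0: "e 0 0 = unit_tensor" and eK: "e K 0 = x"
    using eB[of 0 0] eB[of K 0] B0 BK by auto
  have d_ends: "d 0 0 = 0" "d K 0 = N"
  proof -
    show "d 0 0 = 0" using deg[of 0 unit_tensor "[]"] B0 by (simp add: d_def e0 unit_tensor_def)
    obtain \<alpha> where "x \<alpha> \<noteq> 0" using x(2) by blast
    then show "d K 0 = N" using deg[of K x \<alpha>] supp BK by (simp add: d_def eK)
  qed
  have refine: "\<exists>w. (\<forall>i<card (B k). w i \<noteq> 0 \<longrightarrow> d k i + c = d (Suc k) j) \<and>
      (\<forall>\<alpha>\<in>idx k. e (Suc k) j (\<alpha> @ [c]) = (\<Sum>i<card (B k). e k i \<alpha> * w i))"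
    if kcj: "k < K" "c \<in> {0, 1}" "j < card (B (Suc k))" for k c j
  proof -
    have in_B: "e (Suc k) j \<in> B (Suc k)" using eB kcj by simp
    then obtain \<beta> where \<beta>: "\<beta> \<in> idx (K - Suc k)" "e (Suc k) j = matricization_column x (Suc k) \<beta>"
      using sub[OF kcj(1)] by (auto simp: column_set_def)
    let ?v = "matricization_column x k (c # \<beta>)"
    have slice: "e (Suc k) j (\<alpha> @ [c]) = ?v \<alpha>" if "\<alpha> \<in> idx k" for \<alpha>
      unfolding \<beta>(2) by (rule column_slice) (use kcj that in auto)
    have "c # \<beta> \<in> idx (K - k)"
      using \<beta>(1) kcj Cons_in_idx_iff[of c \<beta> "K - Suc k"] by (simp add: Suc_diff_Suc)
    then have "?v \<in> tensors.span (B k)"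
      using span[of k] kcj(1) by (auto simp: column_set_def)
    moreover have "sum_list \<alpha> + c = d (Suc k) j" if "?v \<alpha> \<noteq> 0" for \<alpha>
    proof -
      have "\<alpha> \<in> idx k" using that by (auto simp: matricization_column_def split: if_splits)
      then show ?thesis
        using slice[of \<alpha>] that deg[OF _ in_B, of "\<alpha> @ [c]"] kcj(1) by (simp add: d_def)
    qed
    moreover have "sum_list \<alpha> = d k i" if "i < card (B k)" "e k i \<alpha> \<noteq> 0" for i \<alpha>
      using that kcj(1) deg[OF _ eB] by (simp add: d_def)
    ultimately obtain w where "\<forall>i<card (B k). w i \<noteq> 0 \<longrightarrow> d k i + c = d (Suc k) j"
      "\<forall>\<alpha>. ?v \<alpha> = (\<Sum>i<card (B k). e k i \<alpha> * w i)"
      using span_coefficients_graded[of ?v "B k" "e k" "card (B k)" "\<lambda>n. n + c = d (Suc k) j" "d k"]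
        e[of k] kcj(1) by auto
    then show ?thesis using slice by auto
  qed
  \<comment> \<open>Stated for all rank functions that agree with the column ranks up to \<open>K\<close>: the column ranks
    themselves serve to invoke minimality, after which \<open>r\<close> is known to be another such function.\<close>
  have construct: "\<exists>Y. mps_rep K q Y x \<and> (\<forall>k<K. \<forall>c\<in>{0, 1}. \<forall>i<q k. \<forall>j<q (Suc k).
      Y (Suc k) c $$ (i, j) \<noteq> 0 \<longrightarrow> d k i + c = d (Suc k) j)"
    if q: "\<And>k. k \<le> K \<Longrightarrow> q k = card (B k)" for q
  proof -
    have "q 0 = 1" "q K = 1" using q B0 BK by auto
    moreover have "\<exists>w. (\<forall>i<q k. w i \<noteq> 0 \<longrightarrow> d k i + c = d (Suc k) j) \<and>
      (\<forall>\<alpha>\<in>idx k. e (Suc k) j (\<alpha> @ [c]) = (\<Sum>i<q k. e k i \<alpha> * w i))"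
      if "k < K" "c \<in> {0, 1}" "j < q (Suc k)" for k c j
      using refine[of k c j] that q[of k] q[of "Suc k"] by simp
    moreover have "e 0 0 [] = 1" by (simp add: e0 unit_tensor_def)
    ultimately obtain Y where "mps_rep K q Y x"
      "\<And>k c i j. k < K \<Longrightarrow> c \<in> {0, 1} \<Longrightarrow> i < q k \<Longrightarrow> j < q (Suc k) \<Longrightarrow>
        Y (Suc k) c $$ (i, j) \<noteq> 0 \<Longrightarrow> d k i + c = d (Suc k) j"
      using graded_mps_of_family[of q K x e d, OF _ _ \<open>0 < K\<close> x(1) _ eK] by blast
    then show ?thesis by blast
  qed
  have rank: "r k = card (B k)" if "k \<le> K" for k
  proof (cases "k = 0 \<or> k = K")
    case True
    then show ?thesis using rep B0 BK by (auto simp: mps_rep_def is_mps_def)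
  next
    case False
    obtain Y' where "mps_rep K (\<lambda>k. card (B k)) Y' x"
      using construct[of "\<lambda>k. card (B k)"] by blast
    then have "r k \<le> card (B k)"
      using min False that unfolding minimal_ranks_def by fastforce
    with card_le[OF that] show ?thesis by simp
  qed
  obtain Y where "mps_rep K r Y x" "\<forall>k<K. \<forall>c\<in>{0, 1}. \<forall>i<r k. \<forall>j<r (Suc k).
      Y (Suc k) c $$ (i, j) \<noteq> 0 \<longrightarrow> d k i + c = d (Suc k) j"
    using construct[of r] rank by blast
  moreover have "d k j \<in> particle_range K N k" if "k \<le> K" "j < r k" for k j
    using deg_range[OF that(1) eB[OF that(1)]] that rank by (simp add: d_def)
  ultimately show thesis
    using d_ends by (intro that[of Y d]) blast+
qed

section \<open>Block-sparse representations of particle number eigenvectors\<close>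

theorem corollary3p4:
  fixes K N :: nat and x :: tensor and r :: "nat \<Rightarrow> nat" and X :: cores
  assumes "x \<in> fock K" and "x \<noteq> (\<lambda>_. 0)"
    and "mps_rep K r X x" and "minimal_ranks K r x"
    and "N \<in> {1..K}"
  shows "op_apply K (number_op K) x = (\<lambda>\<alpha>. real N * x \<alpha>) \<longleftrightarrow>
    (\<exists>Y. mps_rep K r Y x \<and>
      (\<exists>S :: nat \<Rightarrow> nat \<Rightarrow> nat set.
        S 0 0 = {0} \<and> S K N = {0} \<and>
        (\<forall>k\<in>{1..K}.
          (\<forall>n\<in>particle_range K N k.
            S k n \<subseteq> {..<r k} \<and>
            (\<forall>j\<in>S k n.
              op_apply k (number_op_le k) (tau_le r Y k j) = (\<lambda>\<alpha>. real n * tau_le r Y k j \<alpha>) \<and>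
              op_apply (K - k) (number_op_gt K k) (tau_gt K r Y k j)
                = (\<lambda>\<alpha>. (real N - real n) * tau_gt K r Y k j \<alpha>))) \<and>
          (\<forall>i<r (k - 1). \<forall>j<r k. Y k 0 $$ (i, j) \<noteq> 0 \<longrightarrow>
            (\<exists>n\<in>particle_range K N (k - 1) \<inter> particle_range K N k.
              i \<in> S (k - 1) n \<and> j \<in> S k n)) \<and>
          (\<forall>i<r (k - 1). \<forall>j<r k. Y k 1 $$ (i, j) \<noteq> 0 \<longrightarrow>
            (\<exists>n\<in>particle_range K N (k - 1) \<inter> {n. n + 1 \<in> particle_range K N k}.
              i \<in> S (k - 1) n \<and> j \<in> S k (n + 1))))))"
    (is "?eigen \<longleftrightarrow> (\<exists>Y. mps_rep K r Y x \<and> (\<exists>S. ?ends S \<and> ?right S \<and> (\<forall>k\<in>{1..K}. ?blocks Y S k)))")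
proof
  assume ?eigen
  then have supp: "sum_list \<alpha> = N" if "x \<alpha> \<noteq> 0" for \<alpha>
    using that number_op_le_eigen_iff[OF assms(1)] by (simp add: number_op_apply_eq)
  have K: "0 < K" "N \<le> K" using assms(5) by auto
  obtain Y d where Y: "mps_rep K r Y x"
    and graded: "\<And>k c i j. k < K \<Longrightarrow> c \<in> {0, 1} \<Longrightarrow> i < r k \<Longrightarrow> j < r (Suc k) \<Longrightarrow>
      Y (Suc k) c $$ (i, j) \<noteq> 0 \<Longrightarrow> d k i + c = d (Suc k) j"
    and d_range: "\<And>k j. k \<le> K \<Longrightarrow> j < r k \<Longrightarrow> d k j \<in> particle_range K N k"
    and d_ends: "d 0 0 = 0" "d K 0 = N"
    using graded_representation_of_minimal_rank[OF assms(1-4) supp K] by metis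
  have mps: "is_mps K r Y" and r: "r 0 = 1" "r K = 1"
    using Y by (auto simp: mps_rep_def is_mps_def)
  have path: "d k i + sum_list \<alpha> = d (k + l) j"
    if "\<alpha> \<in> idx l" "k + l \<le> K" "i < r k" "j < r (k + l)" "core_prod r Y k \<alpha> $$ (i, j) \<noteq> 0"
    for k l \<alpha> i j
    by (rule core_prod_graded[of K r Y d, OF mps _ that]) (rule graded)
  define S where "S k n = {j. j < r k \<and> d k j = n}" for k n
  have ends: "?ends S" "?right S" using r d_ends by (auto simp: S_def)
  have eigen_le: "op_apply k (number_op_le k) (tau_le r Y k j) = (\<lambda>\<alpha>. real n * tau_le r Y k j \<alpha>)"
    if "k \<le> K" "j \<in> S k n" for k n j
  proof -
    have "tau_le r Y k j \<in> fock k" by (simp add: tau_le_def fock_def)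
    moreover have "sum_list \<alpha> = n" if "tau_le r Y k j \<alpha> \<noteq> 0" for \<alpha>
      using path[of \<alpha> k 0 0 j] that \<open>k \<le> K\<close> \<open>j \<in> S k n\<close> r d_ends
      by (auto simp: tau_le_def S_def split: if_splits)
    ultimately show ?thesis by (simp add: number_op_le_eigen_iff)
  qed
  have eigen_gt: "op_apply (K - k) (number_op_gt K k) (tau_gt K r Y k j)
      = (\<lambda>\<alpha>. (real N - real n) * tau_gt K r Y k j \<alpha>)"
    if "k \<le> K" "j \<in> S k n" for k n j
  proof -
    have "tau_gt K r Y k j \<in> fock (K - k)" by (simp add: tau_gt_def fock_def)
    moreover have "n + sum_list \<alpha> = N" if "tau_gt K r Y k j \<alpha> \<noteq> 0" for \<alpha>
      using path[of \<alpha> "K - k" k j 0] that \<open>k \<le> K\<close> \<open>j \<in> S k n\<close> r d_ends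
      by (auto simp: tau_gt_def S_def split: if_splits)
    ultimately show ?thesis
      using \<open>k \<le> K\<close> by (fastforce simp: number_op_le_eigen_iff number_op_gt_eq_number_op_le)
  qed
  have pred: "k - 1 < K" "Suc (k - 1) = k" if "k \<in> {1..K}" for k
    using that by auto
  have "?blocks Y S k" if k: "k \<in> {1..K}" for k
  proof (intro conjI ballI allI impI)
    fix n assume "n \<in> particle_range K N k"
    show "S k n \<subseteq> {..<r k}" by (auto simp: S_def)
    fix j assume "j \<in> S k n"
    then show "op_apply k (number_op_le k) (tau_le r Y k j) = (\<lambda>\<alpha>. real n * tau_le r Y k j \<alpha>)"
      "op_apply (K - k) (number_op_gt K k) (tau_gt K r Y k j)
        = (\<lambda>\<alpha>. (real N - real n) * tau_gt K r Y k j \<alpha>)"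
      using eigen_le eigen_gt k by auto
  next
    fix i j assume ij: "i < r (k - 1)" "j < r k" "Y k 0 $$ (i, j) \<noteq> 0"
    then have "d (k - 1) i = d k j" using graded[of "k - 1" 0 i j] pred[OF k] by simp
    then show "\<exists>n\<in>particle_range K N (k - 1) \<inter> particle_range K N k. i \<in> S (k - 1) n \<and> j \<in> S k n"
      using ij k d_range[of k j] d_range[of "k - 1" i] by (auto simp: S_def)
  next
    fix i j assume ij: "i < r (k - 1)" "j < r k" "Y k 1 $$ (i, j) \<noteq> 0"
    then have "d (k - 1) i + 1 = d k j" using graded[of "k - 1" 1 i j] pred[OF k] by simp
    then show "\<exists>n\<in>particle_range K N (k - 1) \<inter> {n. n + 1 \<in> particle_range K N k}.
        i \<in> S (k - 1) n \<and> j \<in> S k (n + 1)"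
      using ij k d_range[of k j] d_range[of "k - 1" i] by (auto simp: S_def)
  qed
  then have blocks: "\<forall>k\<in>{1..K}. ?blocks Y S k" by (rule ballI)
  show "\<exists>Y. mps_rep K r Y x \<and> (\<exists>S. ?ends S \<and> ?right S \<and> (\<forall>k\<in>{1..K}. ?blocks Y S k))"
    by (rule exI[of _ Y], rule conjI[OF Y], rule exI[of _ S]) (intro conjI ends blocks)
next
  assume "\<exists>Y. mps_rep K r Y x \<and> (\<exists>S. ?ends S \<and> ?right S \<and> (\<forall>k\<in>{1..K}. ?blocks Y S k))"
  then show ?eigen
  proof (elim exE conjE)
    fix Y S assume Y: "mps_rep K r Y x" and S: "?right S" and blocks: "\<forall>k\<in>{1..K}. ?blocks Y S k"
    have ranges: "K \<in> {1..K}" "N \<in> particle_range K N K" "0 \<in> S K N"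
      using assms(5) S by (auto simp: particle_range_def)
    \<comment> \<open>At the last cut the left partial tensor is the whole tensor \<open>x\<close>.\<close>
    have "op_apply K (number_op_le K) (tau_le r Y K 0) = (\<lambda>\<alpha>. real N * tau_le r Y K 0 \<alpha>)"
      using bspec[OF conjunct2[OF bspec[OF conjunct1[OF bspec[OF blocks ranges(1)]] ranges(2)]] ranges(3)]
      by (rule conjunct1)
    moreover have "tau_le r Y K 0 = x"
      using Y by (simp add: mps_rep_def tau_def tau_le_def)
    ultimately show ?eigen by (simp add: number_op_apply_eq)
  qed
qed

end
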